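(* Let $P=\mathbb{C}[x_{ijk} : i,j,k\in\{0,1\}]$ with the action of $SL_2(\mathbb{C})\times SL_2(\mathbb{C})\times SL_2(\mathbb{C})$ by changes of basis of determinant $1$ along the three directions of the array $(x_{ijk})$. There are no nonzero invariant polynomials that are homogeneous of degree $2$.
   Context: The group $SL_2(\mathbb{C})^3$ acts on $P=\mathbb{C}[x_{ijk}: i,j,k\in\{0,1\}]$ by $\mathbb{C}$-algebra automorphisms: identifying $x_{ijk}$ with the simple tensor $x_i\otimes x_j\otimes x_k\in\mathbb{C}^2\otimes\mathbb{C}^2\otimes\mathbb{C}^2$ (where $x_0,x_1$ is the standard basis of $\mathbb{C}^2$, with $SL_2(\mathbb{C})$ acting by matrix-vector multiplication), a triple $(A,B,D)$ with $A=(a_{pq})$, $B=(b_{pq})$, $D=(d_{pq})$ ($p,q\in\{0,1\}$) sends $x_{ijk}\mapsto\sum_{i',j',k'\in\{0,1\}}a_{i'i}\,b_{j'j}\,d_{k'k}\,x_{i'j'k'}$, and this is extended multiplicatively and linearly to $P$. A polynomial $f\in P$ is invariant if $(A,B,D)\cdot f=f$ for all $(A,B,D)\in SL_2(\mathbb{C})^3$. *)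

theory Defs
  imports "HOL-Analysis.Determinants" "HOL-Library.Poly_Mapping" "HOL-Library.Numeral_Type"
begin

text \<open>
  An index \<open>(i, j, k)\<close> has its entries in the two-element type \<open>2\<close>, whose elements are \<open>0\<close> and \<open>1\<close>
  (the numeral \<open>2\<close> of this type equals \<open>0\<close>).  A polynomial is a finitely supported map from
  monomials, i.e. exponent vectors, to complex coefficients; the ring structure (convolution
  product) is the one of \<^theory>\<open>HOL-Library.Poly_Mapping\<close>.
\<close>

type_synonym idx = "2 \<times> 2 \<times> 2"
type_synonym monomial = "idx \<Rightarrow>\<^sub>0 nat"
type_synonym polynomial = "monomial \<Rightarrow>\<^sub>0 complex"

definition Const :: "complex \<Rightarrow> polynomial" where
  "Const c = Poly_Mapping.single 0 c"

definition Var :: "idx \<Rightarrow> polynomial" where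
  "Var v = Poly_Mapping.single (Poly_Mapping.single v 1) 1"

definition mdegree :: "monomial \<Rightarrow> nat" where
  "mdegree m = (\<Sum>v\<in>UNIV. Poly_Mapping.lookup m v)"

text \<open>The zero polynomial is homogeneous of every degree.\<close>

definition homogeneous :: "nat \<Rightarrow> polynomial \<Rightarrow> bool" where
  "homogeneous d f \<longleftrightarrow> (\<forall>m\<in>Poly_Mapping.keys f. mdegree m = d)"

text \<open>The \<open>\<complex>\<close>-algebra endomorphism sending each variable \<open>Var v\<close> to \<open>s v\<close>.\<close>

definition substitute :: "(idx \<Rightarrow> polynomial) \<Rightarrow> polynomial \<Rightarrow> polynomial" where
  "substitute s f =
     (\<Sum>m\<in>Poly_Mapping.keys f.
        Const (Poly_Mapping.lookup f m) * (\<Prod>v\<in>UNIV. s v ^ Poly_Mapping.lookup m v))"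

definition SL2 :: "(complex ^ 2 ^ 2) set" where
  "SL2 = {A. det A = 1}"

text \<open>
  \<open>A $ p $ q\<close> is the entry in row \<open>p\<close> and column \<open>q\<close>, so a basis vector \<open>x\<^sub>i\<close> goes to column \<open>i\<close>:
  the summation indices below are the row indices.
\<close>

definition act_var :: "complex ^ 2 ^ 2 \<Rightarrow> complex ^ 2 ^ 2 \<Rightarrow> complex ^ 2 ^ 2 \<Rightarrow> idx \<Rightarrow> polynomial" where
  "act_var A B D = (\<lambda>(i, j, k).
     \<Sum>i'\<in>UNIV. \<Sum>j'\<in>UNIV. \<Sum>k'\<in>UNIV.
       Const (A $ i' $ i * B $ j' $ j * D $ k' $ k) * Var (i', j', k'))"

definition act :: "complex ^ 2 ^ 2 \<Rightarrow> complex ^ 2 ^ 2 \<Rightarrow> complex ^ 2 ^ 2 \<Rightarrow> polynomial \<Rightarrow> polynomial" where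
  "act A B D = substitute (act_var A B D)"

definition invariant :: "polynomial \<Rightarrow> bool" where
  "invariant f \<longleftrightarrow> (\<forall>A\<in>SL2. \<forall>B\<in>SL2. \<forall>D\<in>SL2. act A B D f = f)"

lemma Const_0 [simp]: "Const 0 = 0"
  and Const_1 [simp]: "Const 1 = 1"
  and Const_add: "Const (a + b) = Const a + Const b"
  and Const_mult: "Const (a * b) = Const a * Const b"
  by (simp_all add: Const_def single_add mult_single)

lemma substitute_superset:
  assumes "finite S" "Poly_Mapping.keys f \<subseteq> S"
  shows "substitute s f =
     (\<Sum>m\<in>S. Const (Poly_Mapping.lookup f m) * (\<Prod>v\<in>UNIV. s v ^ Poly_Mapping.lookup m v))"
  unfolding substitute_def
  by (rule sum.mono_neutral_left) (use assms in \<open>auto simp: in_keys_iff\<close>)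

lemma substitute_single:
  "substitute s (Poly_Mapping.single m c) =
     Const c * (\<Prod>v\<in>UNIV. s v ^ Poly_Mapping.lookup m v)"
  by (subst substitute_superset[of "{m}"]) auto

lemma substitute_Const: "substitute s (Const c) = Const c"
  using substitute_single[of s 0 c] by (simp add: Const_def)

lemma substitute_Var: "substitute s (Var v) = s v"
proof -
  have "(\<Prod>w\<in>UNIV. s w ^ Poly_Mapping.lookup (Poly_Mapping.single v (1::nat)) w) =
        (\<Prod>w\<in>UNIV. if w = v then s w else 1)"
    by (rule prod.cong) (auto simp: lookup_single when_def)
  then show ?thesis
    unfolding Var_def substitute_single by simp
qed

lemma substitute_add: "substitute s (f + g) = substitute s f + substitute s g"
proof -
  let ?S = "Poly_Mapping.keys f \<union> Poly_Mapping.keys g"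
  have "substitute s h =
     (\<Sum>m\<in>?S. Const (Poly_Mapping.lookup h m) * (\<Prod>v\<in>UNIV. s v ^ Poly_Mapping.lookup m v))"
    if "Poly_Mapping.keys h \<subseteq> ?S" for h
    by (rule substitute_superset) (use that in auto)
  then show ?thesis
    by (simp add: Poly_Mapping.keys_add lookup_add Const_add distrib_right sum.distrib)
qed

lemma polynomial_induct [case_names zero single sum]:
  fixes f :: polynomial
  assumes "P 0" and "\<And>m c. P (Poly_Mapping.single m c)" and "\<And>f g. P f \<Longrightarrow> P g \<Longrightarrow> P (f + g)"
  shows "P f"
proof (induction f rule: update_induct)
  case const
  show ?case by fact
next
  case (update f a b)
  then have "Poly_Mapping.update a b f = f + Poly_Mapping.single a b"
    by (intro poly_mapping_eqI)
       (auto simp: Poly_Mapping.lookup_update lookup_add lookup_single when_def in_keys_iff)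
  then show ?case
    using assms(2,3) update by simp
qed

lemma substitute_zero: "substitute s 0 = 0"
  by (simp add: substitute_def)

lemma substitute_mult: "substitute s (f * g) = substitute s f * substitute s g"
proof (induction f rule: polynomial_induct)
  case zero
  show ?case by (simp add: substitute_zero)
next
  case (single m c)
  show ?case
  proof (induction g rule: polynomial_induct)
    case zero
    show ?case by (simp add: substitute_zero)
  next
    case (single n d)
    show ?case
      by (simp add: mult_single substitute_single Const_mult lookup_add power_add
          prod.distrib mult_ac)
  next
    case (sum g1 g2)
    then show ?case
      by (simp add: distrib_left substitute_add)
  qed
next
  case (sum f1 f2)
  then show ?case
    by (simp add: distrib_right substitute_add)
qed

end

theory Submission
  imports Defs
begin

text \<open>
  Invariance only has to be tested on matrices with one nonzero entry in each column, because these
  send every monomial to a multiple of a monomial, so that they act on the coefficients of a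
  polynomial one at a time.

  The diagonal matrix with entries \<open>t\<close> and \<open>1 / t\<close> in one of the three directions multiplies
  \<open>x\<^sub>u x\<^sub>v\<close> by \<open>t\<^sup>2\<close>, \<open>1\<close> or \<open>1 / t\<^sup>2\<close>, and by \<open>1\<close> only if \<open>u\<close> and \<open>v\<close> differ in that direction.  Taking
  \<open>t = 2\<close> in each direction in turn, the only quadratic monomials that can occur in an invariant are
  \<open>x\<^sub>u x\<^sub>v\<close> with \<open>v\<close> the index complementary to \<open>u\<close> (lemma \<open>invariant_quadratic_support\<close>).

  The Weyl element \<open>w\<close>, with \<open>x\<^sub>0 \<mapsto> x\<^sub>1\<close> and \<open>x\<^sub>1 \<mapsto> - x\<^sub>0\<close>, applied in all three directions at once
  interchanges \<open>x\<^sub>u\<close> and \<open>x\<^sub>v\<close> up to signs.  Each direction contributes to \<open>x\<^sub>u x\<^sub>v\<close> exactly one sign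
  \<open>- 1\<close>, since exactly one of \<open>u\<close> and \<open>v\<close> has the entry \<open>1\<close> there.  As the number of directions is odd,
  \<open>x\<^sub>u x\<^sub>v\<close> goes to \<open>- x\<^sub>u x\<^sub>v\<close>, and its coefficient vanishes.
\<close>

section \<open>Quadratic monomials\<close>

lemma mdegree_add: "mdegree (m + n) = mdegree m + mdegree n"
  by (simp add: mdegree_def lookup_add sum.distrib)

lemma mdegree_single: "mdegree (Poly_Mapping.single u k) = k"
  by (simp add: mdegree_def lookup_single when_def)

lemma mdegree_Suc_split:
  assumes "mdegree m = Suc d"
  obtains u n where "m = Poly_Mapping.single u 1 + n" "mdegree n = d"
proof -
  obtain u where "Poly_Mapping.lookup m u \<noteq> 0"
    using assms unfolding mdegree_def by (metis sum.not_neutral_contains_not_neutral nat.distinct(1))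
  then have "m = Poly_Mapping.single u 1 + (m - Poly_Mapping.single u 1)"
    by (intro poly_mapping_eqI) (auto simp: lookup_add lookup_minus lookup_single when_def)
  moreover from this have "mdegree m = 1 + mdegree (m - Poly_Mapping.single u 1)"
    by (subst mdegree_single[of u 1, symmetric], subst mdegree_add[symmetric]) (rule arg_cong)
  ultimately show thesis
    using that assms by simp
qed

lemma mdegree_2_cases:
  assumes "mdegree m = 2"
  obtains u v where "m = Poly_Mapping.single u 1 + Poly_Mapping.single v 1"
proof -
  obtain u n where n: "m = Poly_Mapping.single u 1 + n" "mdegree n = 1"
    using mdegree_Suc_split[of m 1] assms by (metis Suc_1)
  obtain v k where k: "n = Poly_Mapping.single v 1 + k" "mdegree k = 0"
    using mdegree_Suc_split[of n 0] n(2) by (metis One_nat_def)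
  have "k = 0"
    using k(2) by (intro poly_mapping_eqI) (simp add: mdegree_def split_paired_all)
  then show thesis
    using that n k by simp
qed

lemma prod_power_quadratic:
  fixes c :: "idx \<Rightarrow> 'a::comm_monoid_mult"
  shows "(\<Prod>w\<in>UNIV. c w ^ Poly_Mapping.lookup
           (Poly_Mapping.single u 1 + Poly_Mapping.single v 1) w) = c u * c v"
proof -
  have "(\<Prod>w\<in>UNIV. c w ^ Poly_Mapping.lookup (Poly_Mapping.single x 1) w) = c x" for x
  proof -
    have "(\<Prod>w\<in>UNIV. c w ^ Poly_Mapping.lookup (Poly_Mapping.single x 1) w)
            = (\<Prod>w\<in>UNIV. if w = x then c w else 1)"
      by (rule prod.cong) (auto simp: lookup_single when_def)
    then show ?thesis by simp
  qed
  then show ?thesis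
    by (simp add: lookup_add power_add prod.distrib)
qed

section \<open>Substitutions that permute the variables up to scalars\<close>

lemma Var_power: "Var v ^ k = Poly_Mapping.single (Poly_Mapping.single v k) 1"
  by (induction k) (simp_all add: Var_def mult_single single_add[symmetric])

lemma prod_single:
  fixes g :: "'i \<Rightarrow> monomial" and c :: "'i \<Rightarrow> complex"
  shows "(\<Prod>i\<in>I. Poly_Mapping.single (g i) (c i)) = Poly_Mapping.single (sum g I) (prod c I)"
  by (induction I rule: infinite_finite_induct) (simp_all add: mult_single)

lemma Const_power: "Const c ^ k = Const (c ^ k)"
  by (induction k) (simp_all add: Const_mult)

text \<open>
  Renaming the variables by \<open>\<sigma>\<close> moves the exponent of \<open>v\<close> to \<open>\<sigma> v\<close>, whereas \<open>map_key \<sigma>\<close> is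
  precomposition with \<open>\<sigma>\<close>; for an involution the two agree.  The identity and the index flip, the
  only renamings that are used below, are both involutions.
\<close>

lemma substitute_scaled_involution_single:
  assumes inv: "\<And>v. \<sigma> (\<sigma> v) = v"
  shows "substitute (\<lambda>v. Const (c v) * Var (\<sigma> v)) (Poly_Mapping.single n a) =
         Poly_Mapping.single (Poly_Mapping.map_key \<sigma> n)
           (a * (\<Prod>v\<in>UNIV. c v ^ Poly_Mapping.lookup n v))"
proof -
  have inj: "inj \<sigma>" by (rule inj_on_inverseI[where g = \<sigma>]) (rule inv)
  have "(\<Sum>v\<in>UNIV. Poly_Mapping.single (\<sigma> v) (Poly_Mapping.lookup n v))
          = Poly_Mapping.map_key \<sigma> n"
  proof (rule poly_mapping_eqI)
    fix w
    have "(\<Sum>v\<in>UNIV. Poly_Mapping.lookup n v when \<sigma> v = w)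
            = (\<Sum>v\<in>UNIV. if v = \<sigma> w then Poly_Mapping.lookup n v else 0)"
      by (rule sum.cong) (auto simp: when_def inv)
    then show "Poly_Mapping.lookup (\<Sum>v\<in>UNIV. Poly_Mapping.single (\<sigma> v) (Poly_Mapping.lookup n v)) w
            = Poly_Mapping.lookup (Poly_Mapping.map_key \<sigma> n) w"
      by (simp add: lookup_sum lookup_single map_key.rep_eq[OF inj])
  qed
  then show ?thesis
    unfolding substitute_single power_mult_distrib Const_power Var_power
    by (simp add: Const_def mult_single prod_single)
qed

text \<open>
  Every variable, hence every monomial, is the image of exactly one, so no two terms of \<open>f\<close> can
  contribute to the same coefficient of the image.
\<close>

lemma lookup_substitute_scaled_involution:
  assumes inv: "\<And>v. \<sigma> (\<sigma> v) = v"
  shows "Poly_Mapping.lookup (substitute (\<lambda>v. Const (c v) * Var (\<sigma> v)) f) (Poly_Mapping.map_key \<sigma> m)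
       = Poly_Mapping.lookup f m * (\<Prod>v\<in>UNIV. c v ^ Poly_Mapping.lookup m v)"
proof (induction f rule: polynomial_induct)
  case zero
  show ?case by (simp add: substitute_zero)
next
  case (single n a)
  have inj: "inj \<sigma>" by (rule inj_on_inverseI[where g = \<sigma>]) (rule inv)
  have "Poly_Mapping.map_key \<sigma> n = Poly_Mapping.map_key \<sigma> m \<longleftrightarrow> n = m"
  proof
    assume eq: "Poly_Mapping.map_key \<sigma> n = Poly_Mapping.map_key \<sigma> m"
    show "n = m"
    proof (rule poly_mapping_eqI)
      fix v
      show "Poly_Mapping.lookup n v = Poly_Mapping.lookup m v"
        using arg_cong[OF eq, of "\<lambda>p. Poly_Mapping.lookup p (\<sigma> v)"]
        by (simp add: map_key.rep_eq[OF inj] inv)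
    qed
  qed simp
  then show ?case
    unfolding substitute_scaled_involution_single[OF inv]
    by (auto simp: lookup_single when_def)
next
  case (sum f g)
  then show ?case
    by (simp add: substitute_add lookup_add distrib_right)
qed

section \<open>The torus and the Weyl element\<close>

definition monomial_matrix :: "(2 \<Rightarrow> 2) \<Rightarrow> (2 \<Rightarrow> complex) \<Rightarrow> complex ^ 2 ^ 2" where
  "monomial_matrix \<alpha> a = (\<chi> p q. if p = \<alpha> q then a q else 0)"

lemma act_monomial_matrix:
  "act (monomial_matrix \<alpha> a) (monomial_matrix \<beta> b) (monomial_matrix \<gamma> d) =
   substitute (\<lambda>v. Const (case v of (i, j, k) \<Rightarrow> a i * b j * d k)
                     * Var (case v of (i, j, k) \<Rightarrow> (\<alpha> i, \<beta> j, \<gamma> k)))"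
proof -
  have "act_var (monomial_matrix \<alpha> a) (monomial_matrix \<beta> b) (monomial_matrix \<gamma> d) (i, j, k)
          = Const (a i * b j * d k) * Var (\<alpha> i, \<beta> j, \<gamma> k)" for i j k
  proof -
    have entry: "Const (monomial_matrix \<alpha> a $ i' $ i * monomial_matrix \<beta> b $ j' $ j
                    * monomial_matrix \<gamma> d $ k' $ k) * Var (i', j', k') =
      (if k' = \<gamma> k then if j' = \<beta> j then if i' = \<alpha> i
         then Const (a i * b j * d k) * Var (i', j', k') else 0 else 0 else 0)" for i' j' k'
      by (simp add: monomial_matrix_def)
    show ?thesis
      unfolding act_var_def prod.case entry by simp
  qed
  then show ?thesis
    unfolding act_def by (intro arg_cong[of _ _ substitute]) auto
qed

definition torus_weight :: "complex \<Rightarrow> 2 \<Rightarrow> complex" where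
  "torus_weight t i = (if i = 0 then t else 1 / t)"

definition weyl_sign :: "2 \<Rightarrow> complex" where
  "weyl_sign i = (if i = 0 then 1 else - 1)"

lemma torus_in_SL2: "t \<noteq> 0 \<Longrightarrow> monomial_matrix id (torus_weight t) \<in> SL2"
  by (simp add: SL2_def monomial_matrix_def torus_weight_def det_2)

lemma weyl_in_SL2: "monomial_matrix ((+) 1) weyl_sign \<in> SL2"
  by (simp add: SL2_def monomial_matrix_def weyl_sign_def det_2)

lemma type_2_cases: "(i::2) = 0 \<or> i = 1"
proof -
  have "(2::2) = 0" by simp
  then show ?thesis using exhaust_2[of i] by metis
qed

lemma one_plus_one_type_2: "(1::2) + 1 = 0"
proof -
  have "(2::2) = 0" by simp
  then show ?thesis by (simp only: one_add_one)
qed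

lemma flip_flip: "1 + (1 + (i::2)) = i"
  by (simp only: add.assoc[symmetric] one_plus_one_type_2 add_0_left)

lemma eq_1_plus_iff: "(i::2) = 1 + j \<longleftrightarrow> i \<noteq> j"
  using type_2_cases[of i] type_2_cases[of j]
  by (elim disjE; hypsubst; simp only: one_plus_one_type_2 add_0_right zero_neq_one one_neq_zero
        not_True_eq_False not_False_eq_True simp_thms)

text \<open>A monomial that occurs in an invariant has trivial weight for the torus.\<close>

lemma invariant_torus_weight:
  fixes f :: polynomial
  assumes "invariant f"
    and "Poly_Mapping.lookup f (Poly_Mapping.single u 1 + Poly_Mapping.single v 1) \<noteq> 0"
    and "r \<noteq> 0" "s \<noteq> 0" "t \<noteq> 0"
  shows "(case u of (i, j, k) \<Rightarrow> torus_weight r i * torus_weight s j * torus_weight t k) *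
         (case v of (i, j, k) \<Rightarrow> torus_weight r i * torus_weight s j * torus_weight t k) = 1"
proof -
  let ?m = "Poly_Mapping.single u 1 + Poly_Mapping.single v (1::nat)"
  let ?w = "\<lambda>v. case v of (i, j, k) \<Rightarrow> torus_weight r i * torus_weight s j * torus_weight t k"
  have "f = act (monomial_matrix id (torus_weight r)) (monomial_matrix id (torus_weight s))
              (monomial_matrix id (torus_weight t)) f"
    using assms torus_in_SL2 unfolding invariant_def by metis
  also have "\<dots> = substitute (\<lambda>v. Const (?w v) * Var (id v)) f"
    unfolding act_monomial_matrix by (rule arg_cong[where f = "\<lambda>s. substitute s f"]) auto
  finally have "Poly_Mapping.lookup f (Poly_Mapping.map_key id ?m) =
      Poly_Mapping.lookup f ?m * (?w u * ?w v)"
    using lookup_substitute_scaled_involution[of id ?w f ?m] prod_power_quadratic[of ?w u v] by simp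
  moreover have "Poly_Mapping.map_key id ?m = ?m"
    by (intro poly_mapping_eqI) (simp add: map_key.rep_eq)
  ultimately show ?thesis
    using assms(2) by simp
qed

lemma torus_weight_1: "torus_weight 1 i = 1"
  by (simp add: torus_weight_def)

lemma torus_weight_2_mult_eq_1: "torus_weight 2 i * torus_weight 2 j = 1 \<Longrightarrow> i \<noteq> j"
  by (auto simp: torus_weight_def split: if_splits)

lemma invariant_quadratic_support:
  fixes f :: polynomial
  assumes "invariant f"
    and "Poly_Mapping.lookup f (Poly_Mapping.single (i, j, k) 1 + Poly_Mapping.single (i', j', k') 1) \<noteq> 0"
  shows "i' = 1 + i" "j' = 1 + j" "k' = 1 + k"
  using invariant_torus_weight[OF assms, of 2 1 1] invariant_torus_weight[OF assms, of 1 2 1]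
    invariant_torus_weight[OF assms, of 1 1 2]
  unfolding eq_1_plus_iff by (auto simp: torus_weight_1 dest: torus_weight_2_mult_eq_1)

lemma weyl_sign_mult: "weyl_sign i * weyl_sign (1 + i) = - 1"
  using eq_1_plus_iff[of 0 i] type_2_cases[of i] by (auto simp: weyl_sign_def one_plus_one_type_2)

text \<open>The sign \<open>- 1\<close> on \<open>x\<^sub>u x\<^sub>v\<close> arises as \<open>(- 1)\<^sup>3\<close>, one factor for each direction.\<close>

lemma invariant_complementary_coeff:
  fixes f :: polynomial
  assumes "invariant f"
  shows "Poly_Mapping.lookup f
           (Poly_Mapping.single (i, j, k) 1 + Poly_Mapping.single (1 + i, 1 + j, 1 + k) 1) = 0"
    (is "Poly_Mapping.lookup f ?m = 0")
proof -
  let ?s = "\<lambda>v. case v of (i, j, k) \<Rightarrow> weyl_sign i * weyl_sign j * weyl_sign k"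
  let ?\<sigma> = "\<lambda>v::idx. case v of (i, j, k) \<Rightarrow> (1 + i, 1 + j, 1 + k)"
  have inv: "?\<sigma> (?\<sigma> v) = v" for v
    by (auto simp: flip_flip split: prod.splits)
  then have inj: "inj ?\<sigma>" by (rule inj_on_inverseI)
  have fixed: "Poly_Mapping.map_key ?\<sigma> ?m = ?m"
  proof (rule poly_mapping_eqI)
    fix w
    have "(i, j, k) = ?\<sigma> w \<longleftrightarrow> (1 + i, 1 + j, 1 + k) = w"
      and "(1 + i, 1 + j, 1 + k) = ?\<sigma> w \<longleftrightarrow> (i, j, k) = w"
      by (auto simp: flip_flip split: prod.splits)
    then show "Poly_Mapping.lookup (Poly_Mapping.map_key ?\<sigma> ?m) w = Poly_Mapping.lookup ?m w"
      by (simp add: map_key.rep_eq[OF inj] lookup_add lookup_single when_def)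
  qed
  have "substitute (\<lambda>v. Const (?s v) * Var (?\<sigma> v)) f = f"
    using assms weyl_in_SL2 unfolding invariant_def act_monomial_matrix[symmetric] by blast
  then have "Poly_Mapping.lookup f ?m =
      Poly_Mapping.lookup f ?m * (?s (i, j, k) * ?s (1 + i, 1 + j, 1 + k))"
    using lookup_substitute_scaled_involution[of ?\<sigma> ?s f ?m, OF inv] fixed
      prod_power_quadratic[of ?s "(i, j, k)" "(1 + i, 1 + j, 1 + k)"] by simp
  also have "?s (i, j, k) * ?s (1 + i, 1 + j, 1 + k) =
      (weyl_sign i * weyl_sign (1 + i)) * (weyl_sign j * weyl_sign (1 + j))
        * (weyl_sign k * weyl_sign (1 + k))"
    by (simp add: mult_ac)
  also have "\<dots> = - 1"
    by (simp add: weyl_sign_mult)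
  finally show ?thesis by simp
qed

section \<open>No quadratic invariants\<close>

theorem lemma28:
  fixes f :: polynomial
  assumes "homogeneous 2 f" and "invariant f"
  shows "f = 0"
proof (rule poly_mapping_eqI, rule ccontr)
  fix m
  assume "Poly_Mapping.lookup f m \<noteq> Poly_Mapping.lookup 0 m"
  then have nz: "Poly_Mapping.lookup f m \<noteq> 0" by simp
  then have "mdegree m = 2"
    using assms(1) by (simp add: homogeneous_def in_keys_iff)
  then obtain i j k i' j' k' where
    m: "m = Poly_Mapping.single (i, j, k) 1 + Poly_Mapping.single (i', j', k') 1"
    by (metis mdegree_2_cases prod_cases3)
  then show False
    using invariant_quadratic_support[of f i j k i' j' k'] invariant_complementary_coeff[of f i j k]
      assms(2) nz by simp
qed

end
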